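(* For $i=1,\dots,s$ let $\mathcal{X}_i$ be an experimental region, let $\Xi_i$ be the set of all designs (probability measures) on $\mathcal{X}_i$, and let $\Xi=\Xi_1\times\cdots\times\Xi_s$. For each $i$ let $\mathbf{M}_i(\xi_i)$ be a matrix (the moment matrix) characterizing the design $\xi_i\in\Xi_i$ and satisfying $$\mathbf{M}_i(\xi_i)=\int_{\mathcal{X}_i}\mathbf{M}_i(\delta_{x_i})\,\xi_i(\mathrm{d}x_i).$$ Put $\mathcal{M}_i=\{\mathbf{M}_i(\xi_i):\xi_i\in\Xi_i\}$, $\mathbb{M}(\boldsymbol{\xi})=(\mathbf{M}_1(\xi_1),\dots,\mathbf{M}_s(\xi_s))$ for $\boldsymbol{\xi}=(\xi_1,\dots,\xi_s)\in\Xi$, and $\mathcal{M}=\{\mathbb{M}(\boldsymbol{\xi}):\boldsymbol{\xi}\in\Xi\}=\mathcal{M}_1\times\cdots\times\mathcal{M}_s$. Let $\phi:\mathcal{M}\to(-\infty,\infty]$ be convex and differentiable. a) For $\boldsymbol{\xi}^*=(\xi_1^*,\dots,\xi_s^* )\in\Xi$ the following statements are equivalent: (i) $\boldsymbol{\xi}^*$ minimizes $\phi(\mathbb{M}(\boldsymbol{\xi}))$ over $\boldsymbol{\xi}\in\Xi$; (ii) $\sum_{i=1}^s\Phi_{\mathbf{M}_{i'}(\xi_{i'}^* ),\,i'\neq i}(\mathbf{M}_i(\xi_i^* ),\mathbf{M}_i(\xi_i))\ge 0$ for all $\xi_i\in\Xi_i$, $i=1,\dots,s$; (iii) $\Phi_{\mathbf{M}_{i'}(\xi_{i'}^*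 ),\,i'\neq i}(\mathbf{M}_i(\xi_i^* ),\mathbf{M}_i(\xi_i))\ge 0$ for all $\xi_i\in\Xi_i$, $i=1,\dots,s$; (iv) $\Phi_{\mathbf{M}_{i'}(\xi_{i'}^* ),\,i'\neq i}(\mathbf{M}_i(\xi_i^* ),\mathbf{M}_i(\delta_{x_i}))\ge 0$ for all $x_i\in\mathcal{X}_i$, $i=1,\dots,s$. b) Let $\boldsymbol{\xi}^*=(\xi_1^*,\dots,\xi_s^* )$ minimize $\phi(\mathbb{M}(\boldsymbol{\xi}))$, and let $x_i$ be a support point of $\xi_i^*$, $i\in\{1,\dots,s\}$. Then $\Phi_{\mathbf{M}_{i'}(\xi_{i'}^* ),\,i'\neq i}(\mathbf{M}_i(\xi_i^* ),\mathbf{M}_i(\delta_{x_i}))=0$. c) Let $\boldsymbol{\xi}^*=(\xi_1^*,\dots,\xi_s^* )$ minimize $\phi(\mathbb{M}(\boldsymbol{\xi}))$. Then the point $(\mathbb{M}(\boldsymbol{\xi}^* ),\mathbb{M}(\boldsymbol{\xi}^* ))$ is a saddle point of $\Phi$ in that $$\Phi(\mathbb{M}(\boldsymbol{\xi}^* ),\mathbb{M}(\boldsymbol{\xi}))\ \ge\ 0=\Phi(\mathbb{M}(\boldsymbol{\xi}^* ),\mathbb{M}(\boldsymbol{\xi}^* ))\ \ge\ \Phi(\mathbb{M}(\tilde{\boldsymbol{\xi}}),\mathbb{M}(\boldsymbol{\xi}^* ))\qquad\text{for all }\boldsymbol{\xi},\tilde{\boldsymbol{\xi}}\in\Xi,$$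 and the point $(\mathbf{M}_i(\xi_i^* ),\mathbf{M}_i(\xi_i^* ))$ is a saddle point of $\Phi_{\mathbf{M}_{i'}(\xi_{i'}^* ),\,i'\neq i}$ in that $$\Phi_{\mathbf{M}_{i'}(\xi_{i'}^* ),\,i'\neq i}(\mathbf{M}_i(\xi_i^* ),\mathbf{M}_i(\xi_i))\ \ge\ 0=\Phi_{\mathbf{M}_{i'}(\xi_{i'}^* ),\,i'\neq i}(\mathbf{M}_i(\xi_i^* ),\mathbf{M}_i(\xi_i^* ))\ \ge\ \Phi_{\mathbf{M}_{i'}(\xi_{i'}^* ),\,i'\neq i}(\mathbf{M}_i(\tilde\xi_i),\mathbf{M}_i(\xi_i^* ))$$ for all $\xi_i,\tilde\xi_i\in\Xi_i$, for all $i=1,\dots,s$.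
   Context: $\phi$ is a design criterion, to be minimized, which depends on the designs $\xi_1,\dots,\xi_s$ simultaneously through their moment matrices; no further restrictions (such as finiteness) are imposed on the experimental regions. For $x_i\in\mathcal{X}_i$, $\delta_{x_i}$ denotes the one-point design on $\mathcal{X}_i$ with all observations at $x_i$. The set $\mathcal{M}$ is convex; convex combinations of tuples of matrices are taken componentwise, and convexity and differentiability of $\phi$ are understood with respect to the tuple of moment matrices. For $\mathbb{M},\tilde{\mathbb{M}}\in\mathcal{M}$, the directional derivative of $\phi$ at $\mathbb{M}$ in direction of $\tilde{\mathbb{M}}$ is $$\Phi(\mathbb{M},\tilde{\mathbb{M}})=\lim_{\alpha\searrow 0}\frac1\alpha\Big(\phi((1-\alpha)\mathbb{M}+\alpha\tilde{\mathbb{M}})-\phi(\mathbb{M})\Big).$$ The partial directional derivative of $\phi$ at $\mathbf{M}_i$ in direction of $\tilde{\mathbf{M}}_i$ (with the other components $\mathbf{M}_{i'}$, $i'\neq i$, fixed) is $$\Phi_{\mathbf{M}_{i'},\,i'\neq i}(\mathbf{M}_i,\tilde{\mathbf{M}}_i)=\Phi(\mathbb{M},\breve{\mathbb{M}}),\qquad \mathbb{M}=(\mathbf{M}_1,\dots,\mathbf{M}_s),$$ where $\breve{\mathbb{M}}$ has components $\mathbf{M}_{i'}$ for $i'\neq i$ and $i$-th component $\tilde{\mathbf{M}}_i$.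
   Formalization: φ is not identically ∞ and is finite near (within 𝓜) each point where it is finite; a) assumes φ(M(ξ* )) finite; b) requires that x_i has positive mass or M_i(δ_x) is continuous at x_i; in c) the right inequalities exclude difference quotients of the form ∞−∞. *)

theory Defs
  imports "HOL-Probability.Probability"
begin

text \<open>
  The experimental regions are a family \<open>X\<close> of measurable spaces over a finite index type
  \<open>'s\<close>; only \<open>space (X i)\<close> and \<open>sets (X i)\<close> matter, the measure carried by
  \<open>X i\<close> is irrelevant. A one-point design is \<open>return (X i) x\<close>.

  Moment matrices live in \<open>real ^ 'c ^ 'r\<close>. Families of matrices whose sizes depend on
  \<open>i\<close> are covered by padding with zero rows and columns: all notions below refer to the
  criterion only on the set of attainable tuples, and padding is a linear isomorphism onto its image.
\<close>

definition designs :: "'a measure \<Rightarrow> 'a measure set" where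
  "designs A = space (prob_algebra A)"

definition design_tuples :: "('s \<Rightarrow> 'a measure) \<Rightarrow> ('s \<Rightarrow> 'a measure) set" where
  "design_tuples X = {\<xi>. \<forall>i. \<xi> i \<in> designs (X i)}"

definition moment_tuple ::
  "('s \<Rightarrow> 'a measure \<Rightarrow> real ^ 'c ^ 'r) \<Rightarrow> ('s::finite \<Rightarrow> 'a measure) \<Rightarrow> real ^ 'c ^ 'r ^ 's" where
  "moment_tuple M \<xi> = (\<chi> i. M i (\<xi> i))"

definition moment_tuples ::
  "('s \<Rightarrow> 'a measure) \<Rightarrow> ('s \<Rightarrow> 'a measure \<Rightarrow> real ^ 'c ^ 'r) \<Rightarrow> (real ^ 'c ^ 'r ^ 's::finite) set" where
  "moment_tuples X M = moment_tuple M ` design_tuples X"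

definition optimal_design ::
  "(real ^ 'c ^ 'r ^ 's \<Rightarrow> ereal) \<Rightarrow> ('s \<Rightarrow> 'a measure) \<Rightarrow> ('s \<Rightarrow> 'a measure \<Rightarrow> real ^ 'c ^ 'r) \<Rightarrow>
    ('s::finite \<Rightarrow> 'a measure) \<Rightarrow> bool" where
  "optimal_design \<phi> X M \<xi> \<longleftrightarrow> \<xi> \<in> design_tuples X \<and>
     (\<forall>\<eta>\<in>design_tuples X. \<phi> (moment_tuple M \<xi>) \<le> \<phi> (moment_tuple M \<eta>))"

text \<open>The library's \<open>convex_on\<close> is restricted to real-valued functions.\<close>

definition ereal_convex_on :: "'v::real_vector set \<Rightarrow> ('v \<Rightarrow> ereal) \<Rightarrow> bool" where
  "ereal_convex_on S \<phi> \<longleftrightarrow>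
     (\<forall>A\<in>S. \<forall>B\<in>S. \<forall>\<alpha>. 0 < \<alpha> \<and> \<alpha> < 1 \<longrightarrow>
        \<phi> ((1 - \<alpha>) *\<^sub>R A + \<alpha> *\<^sub>R B) \<le> ereal (1 - \<alpha>) * \<phi> A + ereal \<alpha> * \<phi> B)"

text \<open>
  Frechet differentiability, relative to \<open>S\<close>, at every point where the function is finite. As
  for real-valued functions, this presupposes that the function is finite at all points of \<open>S\<close>
  near the given one.
\<close>

definition ereal_differentiable_on :: "('v::real_normed_vector \<Rightarrow> ereal) \<Rightarrow> 'v set \<Rightarrow> bool" where
  "ereal_differentiable_on \<phi> S \<longleftrightarrow>
     (\<forall>A\<in>S. \<phi> A \<noteq> \<infinity> \<longrightarrow>
        (\<forall>\<^sub>F B in at A within S. \<phi> B \<noteq> \<infinity>) \<and>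
        (\<lambda>B. real_of_ereal (\<phi> B)) differentiable (at A within S))"

definition dir_deriv :: "('v::real_vector \<Rightarrow> ereal) \<Rightarrow> 'v \<Rightarrow> 'v \<Rightarrow> ereal" where
  "dir_deriv \<phi> A B =
     Lim (at_right 0) (\<lambda>\<alpha>::real. (\<phi> ((1 - \<alpha>) *\<^sub>R A + \<alpha> *\<^sub>R B) - \<phi> A) / ereal \<alpha>)"

text \<open>
  For a function with values in \<open>(-\<infinity>, \<infinity>]\<close>, the difference quotients in
  \<^const>\<open>dir_deriv\<close> make sense for small \<open>\<alpha>\<close> unless they have the form
  \<open>\<infinity> - \<infinity>\<close> (which equals \<open>\<infinity>\<close> in type \<^typ>\<open>ereal\<close>).
\<close>

definition dir_deriv_meaningful :: "('v::real_vector \<Rightarrow> ereal) \<Rightarrow> 'v \<Rightarrow> 'v \<Rightarrow> bool" where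
  "dir_deriv_meaningful \<phi> A B \<longleftrightarrow>
     \<phi> A \<noteq> \<infinity> \<or> (\<forall>\<^sub>F \<alpha>::real in at_right 0. \<phi> ((1 - \<alpha>) *\<^sub>R A + \<alpha> *\<^sub>R B) \<noteq> \<infinity>)"

definition replace_component :: "'v ^ 's \<Rightarrow> 's::finite \<Rightarrow> 'v \<Rightarrow> 'v ^ 's" where
  "replace_component T i A = (\<chi> j. if j = i then A else T $ j)"

text \<open>The \<open>i\<close>-th component of \<open>T\<close> is irrelevant here; the others are kept fixed.\<close>

definition partial_dir_deriv ::
  "('v::real_vector ^ 's \<Rightarrow> ereal) \<Rightarrow> 'v ^ 's \<Rightarrow> 's::finite \<Rightarrow> 'v \<Rightarrow> 'v \<Rightarrow> ereal" where
  "partial_dir_deriv \<phi> T i A B = dir_deriv \<phi> (replace_component T i A) (replace_component T i B)"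

definition partial_dir_deriv_meaningful ::
  "('v::real_vector ^ 's \<Rightarrow> ereal) \<Rightarrow> 'v ^ 's \<Rightarrow> 's::finite \<Rightarrow> 'v \<Rightarrow> 'v \<Rightarrow> bool" where
  "partial_dir_deriv_meaningful \<phi> T i A B \<longleftrightarrow>
     dir_deriv_meaningful \<phi> (replace_component T i A) (replace_component T i B)"

text \<open>
  Whenever the open sets are measurable, every point of positive mass is a support point. For other
  support points \<open>x\<close>, the mass near \<open>x\<close> constrains the moment matrix at
  \<open>x\<close> only if one-point moment matrices depend continuously on the point at \<open>x\<close>.
\<close>

definition support_points :: "'a topology \<Rightarrow> 'a measure \<Rightarrow> 'a set" where
  "support_points T \<xi> = {x \<in> topspace T. \<forall>U. openin T U \<and> x \<in> U \<longrightarrow> 0 < emeasure \<xi> U}"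

end

theory Submission
  imports Defs
begin

text \<open>
  Let \<open>L\<close> be the Frechet derivative of \<open>\<phi>\<close> at \<open>A = M(\<xi>)\<close>. Directional
  derivatives at \<open>A\<close> are \<open>\<Phi>(A, B) = L (B - A)\<close>, so they are additive over the
  components, and convexity gives \<open>\<Phi>(A, B) \<le> \<phi> B - \<phi> A\<close>; hence optimality
  is nonnegativity of \<open>L\<close> on all partial directions. Since \<open>M\<^sub>i(\<eta>)\<close> is the mean of
  the one-point moment matrices, one-point directions suffice. At an optimum the one-point
  derivatives are nonnegative with \<open>\<xi>\<^sub>i\<close>-mean \<open>L 0 = 0\<close>, so they vanish almost everywhere.
\<close>

section \<open>Mixtures of designs\<close>

text \<open>The convex combination (1 - \<alpha>) \<xi> + \<alpha> \<eta>, written as a two-stage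
  experiment: toss a coin with success probability \<alpha>, then draw from \<eta> or from \<xi>. In
  this form closure under mixing and the integral formula come from the monad laws of
  \<open>bind\<close>. Since \<open>bernoulli_pmf\<close> clips its parameter to [0,1], the result
  is a design for every real \<alpha>.\<close>

definition mixture :: "real \<Rightarrow> 'a measure \<Rightarrow> 'a measure \<Rightarrow> 'a measure" where
  "mixture \<alpha> \<xi> \<eta> = measure_pmf (bernoulli_pmf \<alpha>) \<bind> (\<lambda>b. if b then \<eta> else \<xi>)"

lemma mixture_design:
  assumes "\<xi> \<in> designs A" "\<eta> \<in> designs A"
  shows "mixture \<alpha> \<xi> \<eta> \<in> designs A"
proof -
  have K: "(\<lambda>b. if b then \<eta> else \<xi>) \<in> measure_pmf (bernoulli_pmf \<alpha>) \<rightarrow>\<^sub>M prob_algebra A"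
    using assms by (simp add: designs_def)
  have P: "measure_pmf (bernoulli_pmf \<alpha>) \<in> space (prob_algebra (measure_pmf (bernoulli_pmf \<alpha>)))"
    by (simp add: space_prob_algebra measure_pmf.prob_space_axioms)
  show ?thesis
    using prob_space_bind'[OF P K] sets_bind'[OF P K]
    by (simp add: designs_def mixture_def space_prob_algebra)
qed

lemma nn_integral_mixture:
  assumes "\<xi> \<in> designs A" "\<eta> \<in> designs A" "f \<in> borel_measurable A" "0 \<le> \<alpha>" "\<alpha> \<le> 1"
  shows "(\<integral>\<^sup>+x. f x \<partial>mixture \<alpha> \<xi> \<eta>) =
    ennreal (1 - \<alpha>) * (\<integral>\<^sup>+x. f x \<partial>\<xi>) + ennreal \<alpha> * (\<integral>\<^sup>+x. f x \<partial>\<eta>)"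
proof -
  have K: "(\<lambda>b. if b then \<eta> else \<xi>) \<in> measure_pmf (bernoulli_pmf \<alpha>) \<rightarrow>\<^sub>M subprob_algebra A"
    using assms(1,2)
    by (simp add: designs_def space_prob_algebra space_subprob_algebra prob_space_imp_subprob_space)
  show ?thesis
    unfolding mixture_def
    by (subst nn_integral_bind[OF assms(3) K]) (simp add: assms(4,5) mult.commute add.commute)
qed

lemma sets_design: "\<xi> \<in> designs A \<Longrightarrow> sets \<xi> = sets A"
  by (simp add: designs_def space_prob_algebra)

lemma measurable_design: "\<xi> \<in> designs A \<Longrightarrow> borel_measurable \<xi> = borel_measurable A"
  by (intro measurable_cong_sets sets_design refl)

text \<open>For nonnegative integrands the Bochner integral agrees with the extended nonnegative
  one, which can be evaluated on a mixture without knowing integrability in advance. Finiteness of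
  the resulting value then yields integrability.\<close>

lemma has_bochner_integral_mixture_nonneg:
  fixes f :: "'a \<Rightarrow> real"
  assumes D: "\<xi> \<in> designs A" "\<eta> \<in> designs A" and \<alpha>: "0 \<le> \<alpha>" "\<alpha> \<le> 1"
    and f: "has_bochner_integral \<xi> f x" "has_bochner_integral \<eta> f y" and nn: "\<And>z. 0 \<le> f z"
  shows "has_bochner_integral (mixture \<alpha> \<xi> \<eta>) f ((1 - \<alpha>) *\<^sub>R x + \<alpha> *\<^sub>R y)"
proof -
  have m: "f \<in> borel_measurable A"
    using f(1) D(1) by (metis has_bochner_integral_iff borel_measurable_integrable measurable_design)
  have x: "(\<integral>\<^sup>+z. f z \<partial>\<xi>) = ennreal x" "0 \<le> x"
    using f(1) nn by (auto simp: has_bochner_integral_iff nn_integral_eq_integral)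
  have y: "(\<integral>\<^sup>+z. f z \<partial>\<eta>) = ennreal y" "0 \<le> y"
    using f(2) nn by (auto simp: has_bochner_integral_iff nn_integral_eq_integral)
  have "(\<integral>\<^sup>+z. f z \<partial>mixture \<alpha> \<xi> \<eta>) = ennreal ((1 - \<alpha>) *\<^sub>R x + \<alpha> *\<^sub>R y)"
    using m x y \<alpha>
    by (subst nn_integral_mixture[OF D]) (auto simp: ennreal_mult ennreal_plus)
  then show ?thesis
    using m x y \<alpha> nn measurable_design[OF mixture_design[OF D]]
    by (intro has_bochner_integral_nn_integral) auto
qed

text \<open>Positive and negative parts reduce the claim to nonnegative integrands.\<close>

lemma has_bochner_integral_mixture_real:
  fixes f :: "'a \<Rightarrow> real"
  assumes D: "\<xi> \<in> designs A" "\<eta> \<in> designs A" and \<alpha>: "0 \<le> \<alpha>" "\<alpha> \<le> 1"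
    and f: "has_bochner_integral \<xi> f x" "has_bochner_integral \<eta> f y"
  shows "has_bochner_integral (mixture \<alpha> \<xi> \<eta>) f ((1 - \<alpha>) *\<^sub>R x + \<alpha> *\<^sub>R y)"
proof -
  have split: "f = (\<lambda>z. max 0 (f z) - max 0 (- f z))"
    by (auto simp: max_def)
  have i: "integrable \<xi> f" "integrable \<eta> f"
    using f by (auto simp: has_bochner_integral_iff)
  note P = has_bochner_integral_mixture_nonneg[OF D \<alpha> has_bochner_integral_integrable
      has_bochner_integral_integrable]
  have "has_bochner_integral (mixture \<alpha> \<xi> \<eta>) (\<lambda>z. max 0 (f z) - max 0 (- f z))
    (((1 - \<alpha>) *\<^sub>R (\<integral>z. max 0 (f z) \<partial>\<xi>) + \<alpha> *\<^sub>R (\<integral>z. max 0 (f z) \<partial>\<eta>)) -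
     ((1 - \<alpha>) *\<^sub>R (\<integral>z. max 0 (- f z) \<partial>\<xi>) + \<alpha> *\<^sub>R (\<integral>z. max 0 (- f z) \<partial>\<eta>)))"
    using i by (intro has_bochner_integral_diff P) auto
  then have "has_bochner_integral (mixture \<alpha> \<xi> \<eta>) f
    (((1 - \<alpha>) *\<^sub>R (\<integral>z. max 0 (f z) \<partial>\<xi>) + \<alpha> *\<^sub>R (\<integral>z. max 0 (f z) \<partial>\<eta>)) -
     ((1 - \<alpha>) *\<^sub>R (\<integral>z. max 0 (- f z) \<partial>\<xi>) + \<alpha> *\<^sub>R (\<integral>z. max 0 (- f z) \<partial>\<eta>)))"
    unfolding split[symmetric] .
  moreover have x: "x = (\<integral>z. max 0 (f z) \<partial>\<xi>) - (\<integral>z. max 0 (- f z) \<partial>\<xi>)"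
    using f(1) i by (subst Bochner_Integration.integral_diff[symmetric])
      (auto simp: has_bochner_integral_iff split[symmetric])
  moreover have y: "y = (\<integral>z. max 0 (f z) \<partial>\<eta>) - (\<integral>z. max 0 (- f z) \<partial>\<eta>)"
    using f(2) i by (subst Bochner_Integration.integral_diff[symmetric])
      (auto simp: has_bochner_integral_iff split[symmetric])
  ultimately show ?thesis
    unfolding x y by (simp add: algebra_simps)
qed

text \<open>The real case is applied to each coordinate, and the coordinates are reassembled over
  \<open>Basis\<close>.\<close>

lemma has_bochner_integral_mixture:
  fixes f :: "'a \<Rightarrow> 'b::euclidean_space"
  assumes D: "\<xi> \<in> designs A" "\<eta> \<in> designs A" and \<alpha>: "0 \<le> \<alpha>" "\<alpha> \<le> 1"
    and f: "has_bochner_integral \<xi> f x" "has_bochner_integral \<eta> f y"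
  shows "has_bochner_integral (mixture \<alpha> \<xi> \<eta>) f ((1 - \<alpha>) *\<^sub>R x + \<alpha> *\<^sub>R y)"
proof -
  let ?v = "(1 - \<alpha>) *\<^sub>R x + \<alpha> *\<^sub>R y"
  have "has_bochner_integral (mixture \<alpha> \<xi> \<eta>) (\<lambda>z. f z \<bullet> b) (?v \<bullet> b)" for b
    using has_bochner_integral_mixture_real[OF D \<alpha>, of "\<lambda>z. f z \<bullet> b" "x \<bullet> b" "y \<bullet> b"] f
    by (auto simp: inner_add_left)
  then have "has_bochner_integral (mixture \<alpha> \<xi> \<eta>)
      (\<lambda>z. \<Sum>b\<in>Basis. (f z \<bullet> b) *\<^sub>R b) (\<Sum>b\<in>Basis. (?v \<bullet> b) *\<^sub>R b)"
    by (intro has_bochner_integral_sum has_bochner_integral_scaleR_left)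
  then show ?thesis
    by (simp only: euclidean_representation)
qed

lemma return_design: "x \<in> space A \<Longrightarrow> return A x \<in> designs A"
  by (simp add: designs_def space_prob_algebra prob_space_return)

text \<open>The integral representation makes each moment matrix affine in the design, so a convex
  combination of two tuples is attained by mixing the designs componentwise. Segments between
  attainable tuples therefore stay where the assumptions on the criterion apply.\<close>

lemma convex_moment_tuples:
  fixes X :: "'s::finite \<Rightarrow> 'a measure"
    and M :: "'s \<Rightarrow> 'a measure \<Rightarrow> real ^ 'c ^ 'r"
  assumes moment: "\<And>i \<xi>. \<xi> \<in> designs (X i) \<Longrightarrow>
          has_bochner_integral \<xi> (\<lambda>x. M i (return (X i) x)) (M i \<xi>)"
  shows "convex (moment_tuples X M)"
  unfolding convex_alt
proof (intro ballI allI impI)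
  fix A B and \<alpha> :: real
  assume "A \<in> moment_tuples X M" "B \<in> moment_tuples X M" and \<alpha>: "0 \<le> \<alpha> \<and> \<alpha> \<le> 1"
  then obtain \<xi> \<eta> where A: "A = moment_tuple M \<xi>" and B: "B = moment_tuple M \<eta>"
    and D: "\<And>i. \<xi> i \<in> designs (X i)" "\<And>i. \<eta> i \<in> designs (X i)"
    by (auto simp: moment_tuples_def design_tuples_def)
  have mix: "mixture \<alpha> (\<xi> i) (\<eta> i) \<in> designs (X i)" for i
    by (intro mixture_design D)
  \<comment> \<open>Both sides are the integral of the one-point matrices over the mixture: one by
    \<open>moment\<close>, the other by the mixture formula. Uniqueness of the integral identifies
    them.\<close>
  have "M i (mixture \<alpha> (\<xi> i) (\<eta> i)) = (1 - \<alpha>) *\<^sub>R M i (\<xi> i) + \<alpha> *\<^sub>R M i (\<eta> i)" for i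
    using has_bochner_integral_mixture[OF D _ _ moment[OF D(1)] moment[OF D(2)]] \<alpha>
      moment[OF mix] has_bochner_integral_eq by blast
  then have "(1 - \<alpha>) *\<^sub>R A + \<alpha> *\<^sub>R B = moment_tuple M (\<lambda>i. mixture \<alpha> (\<xi> i) (\<eta> i))"
    by (simp add: A B moment_tuple_def vec_eq_iff)
  then show "(1 - \<alpha>) *\<^sub>R A + \<alpha> *\<^sub>R B \<in> moment_tuples X M"
    using mix by (auto simp: moment_tuples_def design_tuples_def)
qed

section \<open>Directional derivatives\<close>

lemma eventually_at_right_unit: "\<forall>\<^sub>F \<alpha>::real in at_right 0. 0 < \<alpha> \<and> \<alpha> < 1"
  using eventually_at_right_real[of 0 "1::real"] by simp

lemma dir_deriv_eqI:
  assumes "((\<lambda>\<alpha>::real. (\<phi> ((1 - \<alpha>) *\<^sub>R A + \<alpha> *\<^sub>R B) - \<phi> A) / ereal \<alpha>) \<longlongrightarrow> l) (at_right 0)"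
  shows "dir_deriv \<phi> A B = l"
  unfolding dir_deriv_def by (rule tendsto_Lim[OF _ assms]) simp

text \<open>This is the chain rule along the segment \<open>g\<close> from \<open>A\<close> to
  \<open>B\<close>. The derivative exists only relative to \<open>S\<close>, so the segment must lie
  in \<open>S\<close> and its derivative at 0 is one-sided. The real limit transfers to extended
  reals because the criterion is finite on the segment near \<open>A\<close>.\<close>

lemma difference_quotient_tendsto:
  fixes \<phi> :: "'v::real_normed_vector \<Rightarrow> ereal"
  assumes S: "convex S" "A \<in> S" "B \<in> S"
    and not_minus_infinity: "\<forall>C\<in>S. \<phi> C \<noteq> -\<infinity>"
    and fin: "\<phi> A \<noteq> \<infinity>" "\<forall>\<^sub>F C in at A within S. \<phi> C \<noteq> \<infinity>"
    and L: "((\<lambda>C. real_of_ereal (\<phi> C)) has_derivative L) (at A within S)"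
  shows "((\<lambda>\<alpha>::real. (\<phi> ((1 - \<alpha>) *\<^sub>R A + \<alpha> *\<^sub>R B) - \<phi> A) / ereal \<alpha>)
    \<longlongrightarrow> ereal (L (B - A))) (at_right 0)"
proof -
  define g where "g \<alpha> = (1 - \<alpha>) *\<^sub>R A + \<alpha> *\<^sub>R B" for \<alpha> :: real
  define \<psi> where "\<psi> C = real_of_ereal (\<phi> C)" for C
  have gS: "g \<alpha> \<in> S" if "0 \<le> \<alpha>" "\<alpha> \<le> 1" for \<alpha>
    using S that by (simp add: g_def convex_alt)
  have g: "(g has_derivative (\<lambda>h. h *\<^sub>R (B - A))) (at 0 within {0..1})"
    unfolding g_def by (auto intro!: derivative_eq_intros simp: algebra_simps)
  have "((\<lambda>\<alpha>. \<psi> (g \<alpha>)) has_derivative (\<lambda>h. L (h *\<^sub>R (B - A)))) (at 0 within {0..1})"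
  proof (rule has_derivative_in_compose[OF g])
    have "g ` {0..1} \<subseteq> S"
      using gS by auto
    then show "(\<psi> has_derivative L) (at (g 0) within g ` {0..1})"
      using has_derivative_subset[OF L] by (simp add: \<psi>_def[abs_def] g_def)
  qed
  then have "((\<lambda>\<alpha>. \<psi> (g \<alpha>)) has_field_derivative L (B - A)) (at 0 within {0..1})"
    using has_derivative_bounded_linear[OF L]
    by (intro has_derivative_imp_has_field_derivative)
       (auto simp: linear_cmul[OF bounded_linear.linear] mult.commute)
  then have lim: "((\<lambda>\<alpha>. (\<psi> (g \<alpha>) - \<psi> A) / \<alpha>) \<longlongrightarrow> L (B - A)) (at_right 0)"
    by (simp add: has_field_derivative_iff at_within_Icc_at_right g_def)
  have "(g \<longlongrightarrow> g 0) (at_right 0)"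
    unfolding g_def by (intro tendsto_intros)
  then have "filterlim g (nhds A) (at_right 0)"
    by (simp add: g_def)
  \<comment> \<open>The filter at \<open>A\<close> within \<open>S\<close> omits the point
    \<open>A\<close>, which \<open>g\<close> may hit (for example if \<open>B = A\<close>);
    finiteness at \<open>A\<close> fills this gap.\<close>
  moreover have "\<forall>\<^sub>F C in nhds A. C \<in> S \<longrightarrow> \<phi> C \<noteq> \<infinity>"
    using fin unfolding eventually_at_filter by (auto elim!: eventually_mono)
  ultimately have "\<forall>\<^sub>F \<alpha> in at_right 0. g \<alpha> \<in> S \<longrightarrow> \<phi> (g \<alpha>) \<noteq> \<infinity>"
    by (auto dest: filterlim_iff[THEN iffD1])
  then have "\<forall>\<^sub>F \<alpha> in at_right 0. ereal ((\<psi> (g \<alpha>) - \<psi> A) / \<alpha>) = (\<phi> (g \<alpha>) - \<phi> A) / ereal \<alpha>"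
    using eventually_at_right_unit
  proof eventually_elim
    case (elim \<alpha>)
    then have "g \<alpha> \<in> S" "\<phi> (g \<alpha>) \<noteq> \<infinity>"
      using gS by auto
    then have "\<phi> (g \<alpha>) = ereal (\<psi> (g \<alpha>))" "\<phi> A = ereal (\<psi> A)"
      using not_minus_infinity S fin by (auto simp: \<psi>_def ereal_real)
    then show ?case
      using elim by simp
  qed
  then show ?thesis
    using tendsto_ereal[OF lim] unfolding g_def[symmetric] by (rule tendsto_cong[THEN iffD1])
qed

text \<open>One linear map serves all directions, which is what later allows adding up partial
  derivatives. Convergence is recorded besides the value of \<open>dir_deriv\<close>, since
  inequalities between quotients pass only to genuine limits.\<close>

lemma ereal_differentiable_dir_deriv:
  fixes \<phi> :: "'v::real_normed_vector \<Rightarrow> ereal"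
  assumes "convex S" "\<forall>C\<in>S. \<phi> C \<noteq> -\<infinity>" "ereal_differentiable_on \<phi> S"
    and "A \<in> S" "\<phi> A \<noteq> \<infinity>"
  shows "\<exists>L. bounded_linear L \<and>
    (\<forall>B\<in>S. ((\<lambda>\<alpha>::real. (\<phi> ((1 - \<alpha>) *\<^sub>R A + \<alpha> *\<^sub>R B) - \<phi> A) / ereal \<alpha>)
       \<longlongrightarrow> ereal (L (B - A))) (at_right 0)) \<and>
    (\<forall>B\<in>S. dir_deriv \<phi> A B = ereal (L (B - A)))"
proof -
  from assms obtain L where L: "((\<lambda>C. real_of_ereal (\<phi> C)) has_derivative L) (at A within S)"
    and ev: "\<forall>\<^sub>F C in at A within S. \<phi> C \<noteq> \<infinity>"
    unfolding ereal_differentiable_on_def differentiable_def by blast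
  have "B \<in> S \<Longrightarrow> ((\<lambda>\<alpha>::real. (\<phi> ((1 - \<alpha>) *\<^sub>R A + \<alpha> *\<^sub>R B) - \<phi> A) / ereal \<alpha>)
       \<longlongrightarrow> ereal (L (B - A))) (at_right 0)" for B
    using difference_quotient_tendsto[OF assms(1,4) _ assms(2,5) ev L] by blast
  then show ?thesis
    using has_derivative_bounded_linear[OF L] dir_deriv_eqI by blast
qed

text \<open>The gradient inequality of convex analysis: convexity bounds every difference quotient
  by the total increment, and the bound survives in the limit.\<close>

lemma dir_deriv_le_diff:
  fixes \<phi> :: "'v::real_normed_vector \<Rightarrow> ereal"
  assumes S: "convex S" and not_minus_infinity: "\<forall>C\<in>S. \<phi> C \<noteq> -\<infinity>"
    and diff: "ereal_differentiable_on \<phi> S" and conv: "ereal_convex_on S \<phi>"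
    and A: "A \<in> S" "\<phi> A \<noteq> \<infinity>" and B: "B \<in> S"
  shows "dir_deriv \<phi> A B \<le> \<phi> B - \<phi> A"
proof (cases "\<phi> B = \<infinity>")
  case True
  then show ?thesis using A by (cases "\<phi> A") auto
next
  case False
  then obtain a b where ab: "\<phi> A = ereal a" "\<phi> B = ereal b"
    using A B not_minus_infinity by (cases "\<phi> A"; cases "\<phi> B") auto
  obtain L where lim: "((\<lambda>\<alpha>::real. (\<phi> ((1 - \<alpha>) *\<^sub>R A + \<alpha> *\<^sub>R B) - \<phi> A) / ereal \<alpha>)
       \<longlongrightarrow> ereal (L (B - A))) (at_right 0)" and d: "dir_deriv \<phi> A B = ereal (L (B - A))"
    using ereal_differentiable_dir_deriv[OF S not_minus_infinity diff A] B by blast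
  have "\<forall>\<^sub>F \<alpha>::real in at_right 0. (\<phi> ((1 - \<alpha>) *\<^sub>R A + \<alpha> *\<^sub>R B) - \<phi> A) / ereal \<alpha> \<le> ereal (b - a)"
    using eventually_at_right_unit
  proof eventually_elim
    case (elim \<alpha>)
    let ?C = "(1 - \<alpha>) *\<^sub>R A + \<alpha> *\<^sub>R B"
    have "?C \<in> S"
      using S A B elim by (simp add: convex_alt)
    moreover have "\<phi> ?C \<le> ereal (1 - \<alpha>) * \<phi> A + ereal \<alpha> * \<phi> B"
      using conv A(1) B elim unfolding ereal_convex_on_def by blast
    then have le: "\<phi> ?C \<le> ereal ((1 - \<alpha>) * a + \<alpha> * b)"
      by (simp add: ab)
    \<comment> \<open>The convexity bound excludes \<infinity> and the hypothesis on
      \<open>S\<close> excludes -\<infinity>, so the rest is real arithmetic.\<close>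
    ultimately obtain c where c: "\<phi> ?C = ereal c"
      using not_minus_infinity by (cases "\<phi> ?C") auto
    then have "c - a \<le> (b - a) * \<alpha>"
      using le by (simp add: algebra_simps)
    then show ?case
      using elim by (simp add: c ab divide_simps)
  qed
  then have "ereal (L (B - A)) \<le> ereal (b - a)"
    by (rule tendsto_upperbound[OF lim]) simp
  then show ?thesis
    by (simp add: ab d)
qed

text \<open>The first-order necessary condition: the segment stays in \<open>S\<close>, so
  minimality makes each difference quotient nonnegative.\<close>

lemma dir_deriv_nonneg:
  fixes \<phi> :: "'v::real_normed_vector \<Rightarrow> ereal"
  assumes S: "convex S" and not_minus_infinity: "\<forall>C\<in>S. \<phi> C \<noteq> -\<infinity>"
    and diff: "ereal_differentiable_on \<phi> S"
    and A: "A \<in> S" "\<phi> A \<noteq> \<infinity>" and B: "B \<in> S"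
    and min: "\<forall>C\<in>S. \<phi> A \<le> \<phi> C"
  shows "0 \<le> dir_deriv \<phi> A B"
proof -
  obtain L where lim: "((\<lambda>\<alpha>::real. (\<phi> ((1 - \<alpha>) *\<^sub>R A + \<alpha> *\<^sub>R B) - \<phi> A) / ereal \<alpha>)
       \<longlongrightarrow> ereal (L (B - A))) (at_right 0)" and d: "dir_deriv \<phi> A B = ereal (L (B - A))"
    using ereal_differentiable_dir_deriv[OF S not_minus_infinity diff A] B by blast
  have "\<forall>\<^sub>F \<alpha>::real in at_right 0. 0 \<le> (\<phi> ((1 - \<alpha>) *\<^sub>R A + \<alpha> *\<^sub>R B) - \<phi> A) / ereal \<alpha>"
    using eventually_at_right_unit
  proof eventually_elim
    case (elim \<alpha>)
    then have "(1 - \<alpha>) *\<^sub>R A + \<alpha> *\<^sub>R B \<in> S"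
      using S A B by (simp add: convex_alt)
    then have "0 \<le> \<phi> ((1 - \<alpha>) *\<^sub>R A + \<alpha> *\<^sub>R B) - \<phi> A"
      using min A not_minus_infinity by (intro ereal_diff_positive) auto
    then show ?case
      using elim by (intro zero_le_divide_ereal) auto
  qed
  then show ?thesis
    unfolding d by (rule tendsto_lowerbound[OF lim]) simp
qed

text \<open>This gives the upper half of the saddle point property. At a point of finite value it
  follows from the gradient inequality. At a point of value \<infinity>, meaningfulness keeps the
  values on the segment away from \<infinity>, so the quotients are eventually -\<infinity>.\<close>

lemma dir_deriv_towards_minimizer:
  fixes \<phi> :: "'v::real_normed_vector \<Rightarrow> ereal"
  assumes S: "convex S" and not_minus_infinity: "\<forall>C\<in>S. \<phi> C \<noteq> -\<infinity>"
    and diff: "ereal_differentiable_on \<phi> S" and conv: "ereal_convex_on S \<phi>"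
    and A: "A \<in> S" "\<phi> A \<noteq> \<infinity>" and min: "\<forall>C\<in>S. \<phi> A \<le> \<phi> C"
    and Z: "Z \<in> S" and meaningful: "dir_deriv_meaningful \<phi> Z A"
  shows "dir_deriv \<phi> Z A \<le> 0"
proof (cases "\<phi> Z = \<infinity>")
  case False
  have "dir_deriv \<phi> Z A \<le> \<phi> A - \<phi> Z"
    by (rule dir_deriv_le_diff[OF S not_minus_infinity diff conv Z False A(1)])
  also have "\<dots> \<le> 0"
    using min False A Z not_minus_infinity by (cases "\<phi> A"; cases "\<phi> Z") auto
  finally show ?thesis .
next
  case True
  then have "\<forall>\<^sub>F \<alpha>::real in at_right 0. \<phi> ((1 - \<alpha>) *\<^sub>R Z + \<alpha> *\<^sub>R A) \<noteq> \<infinity>"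
    using meaningful by (simp add: dir_deriv_meaningful_def)
  then have "\<forall>\<^sub>F \<alpha>::real in at_right 0. -\<infinity> = (\<phi> ((1 - \<alpha>) *\<^sub>R Z + \<alpha> *\<^sub>R A) - \<phi> Z) / ereal \<alpha>"
    using eventually_at_right_unit
  proof eventually_elim
    case (elim \<alpha>)
    then show ?case
      by (cases "\<phi> ((1 - \<alpha>) *\<^sub>R Z + \<alpha> *\<^sub>R A)") (auto simp: True)
  qed
  then have "dir_deriv \<phi> Z A = -\<infinity>"
    by (intro dir_deriv_eqI tendsto_cong[THEN iffD1, OF _ tendsto_const])
  then show ?thesis by simp
qed

section \<open>Support points\<close>

text \<open>If \<open>h x\<close> were nonzero, a set of positive mass would avoid the zeros of
  \<open>h\<close>: the atom \<open>{x}\<close>, or an open neighbourhood supplied by continuity at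
  \<open>x\<close>.\<close>

lemma support_point_zero:
  fixes h :: "'a \<Rightarrow> real"
  assumes open_measurable: "\<And>U. openin T U \<Longrightarrow> U \<in> sets \<xi>"
    and AE: "AE y in \<xi>. h y = 0" and x: "x \<in> support_points T \<xi>"
    and alt: "0 < emeasure \<xi> {x} \<or> (h \<longlongrightarrow> h x) (atin T x)"
  shows "h x = 0"
proof (rule ccontr)
  assume nz: "h x \<noteq> 0"
  have "\<exists>U\<in>sets \<xi>. 0 < emeasure \<xi> U \<and> (\<forall>y\<in>U. h y \<noteq> 0)"
    using alt
  proof
    assume "0 < emeasure \<xi> {x}"
    \<comment> \<open>Positive mass already forces \<open>{x}\<close> to be measurable, because
      \<open>emeasure\<close> is 0 on all other sets.\<close>
    then show ?thesis
      using nz by (intro bexI[of _ "{x}"]) (auto simp: emeasure_notin_sets intro: ccontr)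
  next
    assume "(h \<longlongrightarrow> h x) (atin T x)"
    then have "\<forall>\<^sub>F y in atin T x. h y \<noteq> 0"
      using nz by (rule tendsto_imp_eventually_ne)
    then obtain U where "openin T U" "x \<in> U" "\<forall>y\<in>U - {x}. h y \<noteq> 0"
      using x by (auto simp: eventually_atin support_points_def)
    then show ?thesis
      using x nz open_measurable by (intro bexI[of _ U]) (auto simp: support_points_def)
  qed
  then obtain U where U: "U \<in> sets \<xi>" "0 < emeasure \<xi> U" "\<forall>y\<in>U. h y \<noteq> 0"
    by blast
  have "AE y in \<xi>. y \<notin> U"
    using AE by eventually_elim (use U in auto)
  then have "emeasure \<xi> U = 0"
    using U(1) by (simp add: AE_iff_measurable[OF _ refl] sets.sets_into_space Int_absorb1
        flip: Int_def)
  then show False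
    using U by simp
qed

section \<open>The equivalence theorem\<close>

text \<open>A partial direction is an increment in a single block; this is how linearity of the
  derivative splits over the components.\<close>

lemma replace_component_diff:
  fixes A :: "'v::ab_group_add ^ 's::finite"
  shows "replace_component A i C - A = axis i (C - A $ i)"
  by (simp add: replace_component_def axis_def vec_eq_iff)

lemma replace_component_same: "replace_component A i (A $ i) = A"
  by (simp add: replace_component_def vec_eq_iff)

lemma bounded_linear_axis: "bounded_linear (axis i :: 'v::euclidean_space \<Rightarrow> 'v ^ 's::finite)"
  by (intro linear_conv_bounded_linear[THEN iffD1] linearI) (auto simp: axis_def vec_eq_iff)

lemma sum_axis: "(\<Sum>i\<in>UNIV. axis i (v $ i)) = (v :: 'v::comm_monoid_add ^ 's::finite)"
  by (simp add: vec_eq_iff axis_def)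

text \<open>The equivalences are stated at points of finite value: elsewhere quotients of the form
  \<infinity> - \<infinity> evaluate to \<infinity> and could satisfy the derivative conditions
  without optimality. The meaningfulness premises exclude the same form from the upper saddle
  inequalities.\<close>

theorem theorem2:
  fixes X :: "'s::finite \<Rightarrow> 'a measure"
    and T :: "'s \<Rightarrow> 'a topology"
    and M :: "'s \<Rightarrow> 'a measure \<Rightarrow> real ^ 'c ^ 'r"
    and \<phi> :: "real ^ 'c ^ 'r ^ 's \<Rightarrow> ereal"
  assumes top_space: "\<And>i. topspace (T i) = space (X i)"
    and open_measurable: "\<And>i U. openin (T i) U \<Longrightarrow> U \<in> sets (X i)"
    and moment: "\<And>i \<xi>. \<xi> \<in> designs (X i) \<Longrightarrow>
          has_bochner_integral \<xi> (\<lambda>x. M i (return (X i) x)) (M i \<xi>)"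
    and not_minus_infinity: "\<And>A. A \<in> moment_tuples X M \<Longrightarrow> \<phi> A \<noteq> -\<infinity>"
    and proper: "\<exists>A\<in>moment_tuples X M. \<phi> A \<noteq> \<infinity>"
    and convex: "ereal_convex_on (moment_tuples X M) \<phi>"
    and differentiable: "ereal_differentiable_on \<phi> (moment_tuples X M)"
  shows
    "(\<forall>\<xi>\<in>design_tuples X. \<phi> (moment_tuple M \<xi>) \<noteq> \<infinity> \<longrightarrow>
        (optimal_design \<phi> X M \<xi> \<longleftrightarrow>
          (\<forall>\<eta>\<in>design_tuples X.
            0 \<le> (\<Sum>i\<in>UNIV. partial_dir_deriv \<phi> (moment_tuple M \<xi>) i (M i (\<xi> i)) (M i (\<eta> i))))) \<and>
        (optimal_design \<phi> X M \<xi> \<longleftrightarrow>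
          (\<forall>i. \<forall>\<eta>\<in>designs (X i).
            0 \<le> partial_dir_deriv \<phi> (moment_tuple M \<xi>) i (M i (\<xi> i)) (M i \<eta>))) \<and>
        (optimal_design \<phi> X M \<xi> \<longleftrightarrow>
          (\<forall>i. \<forall>x\<in>space (X i).
            0 \<le> partial_dir_deriv \<phi> (moment_tuple M \<xi>) i (M i (\<xi> i)) (M i (return (X i) x))))) \<and>
     (\<forall>\<xi>. optimal_design \<phi> X M \<xi> \<longrightarrow>
        (\<forall>i. \<forall>x\<in>support_points (T i) (\<xi> i).
          0 < emeasure (\<xi> i) {x} \<or>
          ((\<lambda>y. M i (return (X i) y)) \<longlongrightarrow> M i (return (X i) x)) (atin (T i) x) \<longrightarrow>
          partial_dir_deriv \<phi> (moment_tuple M \<xi>) i (M i (\<xi> i)) (M i (return (X i) x)) = 0)) \<and>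
     (\<forall>\<xi>. optimal_design \<phi> X M \<xi> \<longrightarrow>
        (\<forall>\<eta>\<in>design_tuples X. 0 \<le> dir_deriv \<phi> (moment_tuple M \<xi>) (moment_tuple M \<eta>)) \<and>
        dir_deriv \<phi> (moment_tuple M \<xi>) (moment_tuple M \<xi>) = 0 \<and>
        (\<forall>\<zeta>\<in>design_tuples X.
          dir_deriv_meaningful \<phi> (moment_tuple M \<zeta>) (moment_tuple M \<xi>) \<longrightarrow>
          dir_deriv \<phi> (moment_tuple M \<zeta>) (moment_tuple M \<xi>) \<le> 0) \<and>
        (\<forall>i.
          (\<forall>\<eta>\<in>designs (X i).
            0 \<le> partial_dir_deriv \<phi> (moment_tuple M \<xi>) i (M i (\<xi> i)) (M i \<eta>)) \<and>
          partial_dir_deriv \<phi> (moment_tuple M \<xi>) i (M i (\<xi> i)) (M i (\<xi> i)) = 0 \<and>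
          (\<forall>\<zeta>\<in>designs (X i).
            partial_dir_deriv_meaningful \<phi> (moment_tuple M \<xi>) i (M i \<zeta>) (M i (\<xi> i)) \<longrightarrow>
            partial_dir_deriv \<phi> (moment_tuple M \<xi>) i (M i \<zeta>) (M i (\<xi> i)) \<le> 0)))"
proof -

  \<comment> \<open>Attainable tuples and optimal values\<close>
  let ?S = "moment_tuples X M"
  let ?P = "\<lambda>\<xi> i. partial_dir_deriv \<phi> (moment_tuple M \<xi>) i"
  have S: "Convex.convex ?S"
    using moment by (rule convex_moment_tuples)
  note diff_facts = S ballI[of ?S "\<lambda>C. \<phi> C \<noteq> -\<infinity>", OF not_minus_infinity] differentiable
  have in_S: "moment_tuple M \<xi> \<in> ?S" if "\<xi> \<in> design_tuples X" for \<xi>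
    using that by (simp add: moment_tuples_def)
  have replace_S: "replace_component (moment_tuple M \<xi>) i (M i \<eta>) \<in> ?S"
    if "\<xi> \<in> design_tuples X" "\<eta> \<in> designs (X i)" for \<xi> i \<eta>
  proof -
    have "replace_component (moment_tuple M \<xi>) i (M i \<eta>) = moment_tuple M (\<xi>(i := \<eta>))"
      by (simp add: replace_component_def moment_tuple_def vec_eq_iff)
    moreover have "\<xi>(i := \<eta>) \<in> design_tuples X"
      using that by (simp add: design_tuples_def)
    ultimately show ?thesis
      by (simp add: in_S)
  qed
  \<comment> \<open>Component \<open>i\<close> of the base tuple already is
    \<open>M i (\<xi> i)\<close>, so the base point of the partial derivative is the tuple
    itself.\<close>
  have partial: "?P \<xi> i (M i (\<xi> i)) B =
      dir_deriv \<phi> (moment_tuple M \<xi>) (replace_component (moment_tuple M \<xi>) i B)" for \<xi> i B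
    using replace_component_same[of "moment_tuple M \<xi>" i]
    by (simp add: partial_dir_deriv_def moment_tuple_def)
  have min: "\<forall>C\<in>?S. \<phi> (moment_tuple M \<xi>) \<le> \<phi> C" if "optimal_design \<phi> X M \<xi>" for \<xi>
    using that by (auto simp: optimal_design_def moment_tuples_def)
  \<comment> \<open>An optimal value lies below the finite value supplied by
    \<open>proper\<close>.\<close>
  have design: "\<xi> \<in> design_tuples X" and finite: "\<phi> (moment_tuple M \<xi>) \<noteq> \<infinity>"
    if "optimal_design \<phi> X M \<xi>" for \<xi>
    using that proper min[OF that] by (auto simp: optimal_design_def)

  \<comment> \<open>Splitting the derivative into blocks\<close>
  have gradient: "\<exists>G. (\<forall>i. bounded_linear (G i)) \<and>
      (\<forall>i. \<forall>\<eta>\<in>designs (X i). ?P \<xi> i (M i (\<xi> i)) (M i \<eta>) = ereal (G i (M i \<eta> - M i (\<xi> i)))) \<and>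
      (\<forall>\<eta>\<in>design_tuples X. dir_deriv \<phi> (moment_tuple M \<xi>) (moment_tuple M \<eta>) =
        ereal (\<Sum>i\<in>UNIV. G i (M i (\<eta> i) - M i (\<xi> i))))"
    if \<xi>: "\<xi> \<in> design_tuples X" and fin: "\<phi> (moment_tuple M \<xi>) \<noteq> \<infinity>" for \<xi>
  proof -
    obtain L where L: "bounded_linear L"
      and d[rule_format]: "\<forall>B\<in>?S. dir_deriv \<phi> (moment_tuple M \<xi>) B = ereal (L (B - moment_tuple M \<xi>))"
      using ereal_differentiable_dir_deriv[OF diff_facts in_S[OF \<xi>] fin] by blast
    \<comment> \<open>\<open>G i\<close> is the block of the derivative that acts on perturbations
      of component \<open>i\<close> alone.\<close>
    define G where "G i C = L (axis i C)" for i C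
    have "bounded_linear (G i)" for i
      unfolding G_def by (rule bounded_linear_compose[OF L bounded_linear_axis])
    moreover have "?P \<xi> i (M i (\<xi> i)) (M i \<eta>) = ereal (G i (M i \<eta> - M i (\<xi> i)))"
      if "\<eta> \<in> designs (X i)" for i \<eta>
      unfolding partial d[OF replace_S[OF \<xi> that]] G_def replace_component_diff
      by (simp add: moment_tuple_def)
    moreover have "dir_deriv \<phi> (moment_tuple M \<xi>) (moment_tuple M \<eta>) =
        ereal (\<Sum>i\<in>UNIV. G i (M i (\<eta> i) - M i (\<xi> i)))" if "\<eta> \<in> design_tuples X" for \<eta>
    proof -
      have "(\<Sum>i\<in>UNIV. axis i (M i (\<eta> i) - M i (\<xi> i))) = moment_tuple M \<eta> - moment_tuple M \<xi>"
        by (subst sum_axis[symmetric]) (simp add: moment_tuple_def)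
      then show ?thesis
        unfolding d[OF in_S[OF that]] G_def
        using linear_sum[OF bounded_linear.linear[OF L], of "\<lambda>i. axis i (M i (\<eta> i) - M i (\<xi> i))" UNIV]
        by simp
    qed
    ultimately show ?thesis by blast
  qed

  \<comment> \<open>A bounded linear functional commutes with the integral, and the constant
    \<open>C\<close> integrates to itself since \<eta> has total mass 1.\<close>
  have mean: "has_bochner_integral \<eta> (\<lambda>x. G (M i (return (X i) x) - C)) (G (M i \<eta> - C))"
    if "bounded_linear G" "\<eta> \<in> designs (X i)" for G :: "real ^ 'c ^ 'r \<Rightarrow> real" and i \<eta> C
  proof -
    interpret prob_space \<eta>
      using that by (simp add: designs_def space_prob_algebra)
    have "has_bochner_integral \<eta> (\<lambda>x. C) C"
      by (simp add: has_bochner_integral_iff prob_space)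
    then show ?thesis
      using that moment
      by (intro has_bochner_integral_bounded_linear[OF that(1)] has_bochner_integral_diff)
  qed

  have nonneg: "0 \<le> ?P \<xi> i (M i (\<xi> i)) (M i \<eta>)"
    if "optimal_design \<phi> X M \<xi>" "\<eta> \<in> designs (X i)" for \<xi> i \<eta>
    unfolding partial
    using that by (intro dir_deriv_nonneg[OF diff_facts] in_S replace_S design finite min)

  \<comment> \<open>Equivalent conditions for optimality\<close>
  have a: "(optimal_design \<phi> X M \<xi> \<longleftrightarrow>
          (\<forall>\<eta>\<in>design_tuples X. 0 \<le> (\<Sum>i\<in>UNIV. ?P \<xi> i (M i (\<xi> i)) (M i (\<eta> i))))) \<and>
        (optimal_design \<phi> X M \<xi> \<longleftrightarrow>
          (\<forall>i. \<forall>\<eta>\<in>designs (X i). 0 \<le> ?P \<xi> i (M i (\<xi> i)) (M i \<eta>))) \<and>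
        (optimal_design \<phi> X M \<xi> \<longleftrightarrow>
          (\<forall>i. \<forall>x\<in>space (X i). 0 \<le> ?P \<xi> i (M i (\<xi> i)) (M i (return (X i) x))))"
    (is "(?i \<longleftrightarrow> ?ii) \<and> (?i \<longleftrightarrow> ?iii) \<and> (?i \<longleftrightarrow> ?iv)")
    if \<xi>: "\<xi> \<in> design_tuples X" and fin: "\<phi> (moment_tuple M \<xi>) \<noteq> \<infinity>" for \<xi>
  proof -
    obtain G where G[rule_format]: "\<forall>i. bounded_linear (G i)"
      and P[rule_format]: "\<forall>i. \<forall>\<eta>\<in>designs (X i).
        ?P \<xi> i (M i (\<xi> i)) (M i \<eta>) = ereal (G i (M i \<eta> - M i (\<xi> i)))"
      and D[rule_format]: "\<forall>\<eta>\<in>design_tuples X. dir_deriv \<phi> (moment_tuple M \<xi>) (moment_tuple M \<eta>) =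
        ereal (\<Sum>i\<in>UNIV. G i (M i (\<eta> i) - M i (\<xi> i)))"
      using gradient[OF \<xi> fin] by blast
    have "?i \<Longrightarrow> ?iii"
      using nonneg by blast
    moreover have "?iii \<Longrightarrow> ?ii"
      by (auto simp: design_tuples_def intro!: sum_nonneg)
    \<comment> \<open>All summands in (ii) are finite and add up to the full directional derivative,
      to which the gradient inequality applies.\<close>
    moreover have "?i" if ?ii
      unfolding optimal_design_def
    proof (intro conjI ballI \<xi>)
      fix \<eta> assume \<eta>: "\<eta> \<in> design_tuples X"
      have "0 \<le> (\<Sum>i\<in>UNIV. ?P \<xi> i (M i (\<xi> i)) (M i (\<eta> i)))"
        using that \<eta> by blast
      also have "\<dots> = dir_deriv \<phi> (moment_tuple M \<xi>) (moment_tuple M \<eta>)"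
        using \<eta> by (simp add: D P design_tuples_def)
      also have "\<dots> \<le> \<phi> (moment_tuple M \<eta>) - \<phi> (moment_tuple M \<xi>)"
        using \<xi> \<eta> fin by (intro dir_deriv_le_diff[OF diff_facts convex] in_S)
      finally show "\<phi> (moment_tuple M \<xi>) \<le> \<phi> (moment_tuple M \<eta>)"
        using fin not_minus_infinity[OF in_S[OF \<xi>]]
        by (cases "\<phi> (moment_tuple M \<xi>)"; cases "\<phi> (moment_tuple M \<eta>)") auto
    qed
    moreover have "?iii \<Longrightarrow> ?iv"
      by (auto simp: return_design)
    \<comment> \<open>Averaging the one-point inequalities over \<eta> gives the inequality for
      \<eta>.\<close>
    moreover have "?iii" if iv: ?iv
    proof (intro allI ballI)
      fix i \<eta> assume \<eta>: "\<eta> \<in> designs (X i)"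
      then have "space \<eta> = space (X i)"
        using sets_design sets_eq_imp_space_eq by blast
      then have "0 \<le> G i (M i (return (X i) x) - M i (\<xi> i))" if "x \<in> space \<eta>" for x
        using iv[rule_format, of x i] that P[OF return_design, of x i] by simp
      then have "0 \<le> (\<integral>x. G i (M i (return (X i) x) - M i (\<xi> i)) \<partial>\<eta>)"
        by (intro integral_nonneg_AE) simp
      then have "0 \<le> G i (M i \<eta> - M i (\<xi> i))"
        using mean[OF G[of i] \<eta>, of "M i (\<xi> i)"] by (simp add: has_bochner_integral_iff)
      then show "0 \<le> ?P \<xi> i (M i (\<xi> i)) (M i \<eta>)"
        by (simp add: P[OF \<eta>])
    qed
    ultimately show ?thesis by blast
  qed

  \<comment> \<open>Vanishing derivatives at support points\<close>
  have b: "?P \<xi> i (M i (\<xi> i)) (M i (return (X i) x)) = 0"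
    if opt: "optimal_design \<phi> X M \<xi>" and x: "x \<in> support_points (T i) (\<xi> i)"
      and alt: "0 < emeasure (\<xi> i) {x} \<or>
        ((\<lambda>y. M i (return (X i) y)) \<longlongrightarrow> M i (return (X i) x)) (atin (T i) x)" for \<xi> i x
  proof -
    obtain G where G[rule_format]: "\<forall>i. bounded_linear (G i)"
      and P[rule_format]: "\<forall>i. \<forall>\<eta>\<in>designs (X i).
        ?P \<xi> i (M i (\<xi> i)) (M i \<eta>) = ereal (G i (M i \<eta> - M i (\<xi> i)))"
      using gradient[OF design[OF opt] finite[OF opt]] by blast
    define h where "h y = G i (M i (return (X i) y) - M i (\<xi> i))" for y
    have \<xi>: "\<xi> i \<in> designs (X i)"
      using design[OF opt] by (simp add: design_tuples_def)
    have h: "?P \<xi> i (M i (\<xi> i)) (M i (return (X i) y)) = ereal (h y)" if "y \<in> space (X i)" for y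
      using that by (simp add: P return_design h_def)
    have "0 \<le> h y" if "y \<in> space (X i)" for y
      using nonneg[OF opt return_design[OF that]] h[OF that] by simp
    then have "AE y in \<xi> i. 0 \<le> h y"
      using sets_eq_imp_space_eq[OF sets_design[OF \<xi>]] by auto
    \<comment> \<open>The mean of \<open>h\<close> is \<open>G i\<close> applied to
      \<open>M i (\<xi> i) - M i (\<xi> i)\<close>. A nonnegative function with mean 0 vanishes
      almost everywhere.\<close>
    moreover have "has_bochner_integral (\<xi> i) h 0"
      using mean[OF G[of i] \<xi>, of "M i (\<xi> i)"]
      by (simp add: h_def[abs_def] linear_0 bounded_linear.linear[OF G])
    ultimately have "AE y in \<xi> i. h y = 0"
      using integral_nonneg_eq_0_iff_AE[of "\<xi> i" h] by (simp add: has_bochner_integral_iff)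
    moreover have "0 < emeasure (\<xi> i) {x} \<or> (h \<longlongrightarrow> h x) (atin (T i) x)"
      using alt by (auto simp: h_def[abs_def] intro!: bounded_linear.tendsto[OF G] tendsto_diff)
    ultimately have "h x = 0"
      using open_measurable[of i] x sets_design[OF \<xi>]
      by (intro support_point_zero[of "T i" "\<xi> i" h x]) auto
    moreover have "x \<in> space (X i)"
      using x top_space by (auto simp: support_points_def)
    ultimately show ?thesis
      using h by simp
  qed

  \<comment> \<open>Saddle point properties\<close>
  have c0: "dir_deriv \<phi> (moment_tuple M \<xi>) (moment_tuple M \<xi>) = 0"
    if opt: "optimal_design \<phi> X M \<xi>" for \<xi>
  proof -
    obtain L where "bounded_linear L" "dir_deriv \<phi> (moment_tuple M \<xi>) (moment_tuple M \<xi>) =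
        ereal (L (moment_tuple M \<xi> - moment_tuple M \<xi>))"
      using ereal_differentiable_dir_deriv[OF diff_facts in_S[OF design[OF opt]] finite[OF opt]]
        in_S[OF design[OF opt]] by blast
    then show ?thesis
      by (simp add: linear_0 bounded_linear.linear)
  qed
  have c0': "?P \<xi> i (M i (\<xi> i)) (M i (\<xi> i)) = 0" if "optimal_design \<phi> X M \<xi>" for \<xi> i
    using c0[OF that] replace_component_same[of "moment_tuple M \<xi>" i]
    by (simp add: partial_dir_deriv_def moment_tuple_def)
  have c1: "0 \<le> dir_deriv \<phi> (moment_tuple M \<xi>) (moment_tuple M \<eta>)"
    if "optimal_design \<phi> X M \<xi>" "\<eta> \<in> design_tuples X" for \<xi> \<eta>
    using that by (intro dir_deriv_nonneg[OF diff_facts] in_S finite min) (auto intro: design)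
  have towards: "dir_deriv \<phi> Z (moment_tuple M \<xi>) \<le> 0"
    if "optimal_design \<phi> X M \<xi>" "Z \<in> ?S" "dir_deriv_meaningful \<phi> Z (moment_tuple M \<xi>)" for \<xi> Z
    using that
    by (intro dir_deriv_towards_minimizer[OF diff_facts convex] in_S design finite min)
  \<comment> \<open>Putting \<open>M i (\<xi> i)\<close> back into component \<open>i\<close>
    restores the optimal tuple, so the partial direction also ends at the global minimizer and
    \<open>towards\<close> applies.\<close>
  have c2: "?P \<xi> i (M i \<zeta>) (M i (\<xi> i)) \<le> 0"
    if opt: "optimal_design \<phi> X M \<xi>" and \<zeta>: "\<zeta> \<in> designs (X i)"
      and "partial_dir_deriv_meaningful \<phi> (moment_tuple M \<xi>) i (M i \<zeta>) (M i (\<xi> i))" for \<xi> i \<zeta>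
    using towards[OF opt replace_S[OF design[OF opt] \<zeta>]] that(3)
      replace_component_same[of "moment_tuple M \<xi>" i]
    by (simp add: partial_dir_deriv_def partial_dir_deriv_meaningful_def moment_tuple_def)

  show ?thesis
    by (intro conjI allI ballI impI;
        rule a[THEN conjunct1] a[THEN conjunct2, THEN conjunct1] a[THEN conjunct2, THEN conjunct2]
          b c0 c0' c1 c2 nonneg towards[OF _ in_S]; assumption)
qed

end
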